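(* Let $d\geq1$ and let $\mathbb{P}$ be a probability measure on $\Omega=\{-,+\}^{\mathbb{Z}^d}$ with coupling matrix $D^\sigma=(D^\sigma_{x,y})_{x,y\in\mathbb{Z}^d}$. For $p\in\mathbb{N}$ put $\mathcal{D}^{(2p)}_{x,y}:=\mathbb{E}[(D^\sigma_{x,y})^{2p}]^{1/2p}$, $x,y\in\mathbb{Z}^d$. Then for any local function $g:\Omega\to\mathbb{R}$ and any $p\in\mathbb{N}$, $$\mathbb{E}\left[(g-\mathbb{E}g)^{2p}\right]\leq(20p)^{2p}\,\|\mathcal{D}^{(2p)}\|^{2p}_{\ell^2(\mathbb{Z}^d)}\,\|\delta g\|^{2p}_{\ell^2(\mathbb{Z}^d)}.$$
   Context: $\mathbb{N}=\{1,2,\dots\}$. A function $g:\Omega\to\mathbb{R}$ is local if it depends only on the coordinates in some finite $\Lambda\subset\mathbb{Z}^d$. For $\sigma\in\Omega$, $\sigma^x$ is the configuration obtained by flipping the spin at $x$; $\delta_xg=\sup_\sigma|g(\sigma^x)-g(\sigma)|$, $\delta g=(\delta_xg)_{x\in\mathbb{Z}^d}$ and $\|\delta g\|^2_{\ell^2(\mathbb{Z}^d)}=\sum_{x}(\delta_xg)^2$. For a matrix $M$ indexed by $\mathbb{Z}^d\times\mathbb{Z}^d$, $\|M\|_{\ell^2(\mathbb{Z}^d)}\in[0,\infty]$ is its operator norm on $\ell^2(\mathbb{Z}^d)$ (if it is infinite the right-hand side is $+\infty$ unless $\delta g=0$, in which case it is $0$). Ordering: $\Gamma:\mathbb{Z}^d\to\mathbb{N}$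 is a fixed bijection, the "spiraling enumeration" of $\mathbb{Z}^d$ (the origin comes first, then the sites of the successive shells around the origin are enumerated in a spiral). Write $y\le x$ if $\Gamma(y)\leq\Gamma(x)$, $(\leq x)=\{y:\Gamma(y)\leq\Gamma(x)\}$ and $(<x)=\{y:\Gamma(y)<\Gamma(x)\}$. Coupling matrix: for $\sigma\in\Omega$ and $x\in\mathbb{Z}^d$ let $\mathbb{P}(\cdot\mid\sigma_{<x},+_x)$ and $\mathbb{P}(\cdot\mid\sigma_{<x},-_x)$ be (fixed versions of) the conditional measures given that the configuration equals $\sigma$ on $(<x)$ and equals $+$, respectively $-$, at $x$, regarded as measures on $\Omega$. Let $\hat{\mathbb{P}}^\sigma_{x,+,-}$ be their maximal coupling, i.e. a (fixed choice of) joint law of a pair $(X_1,X_2)$ with these marginals for which the probability that $X_1$ and $X_2$ coincide off $(\le x)$ is as large as possible. Then $D^\sigma_{x,y}:=\hat{\mathbb{P}}^\sigma_{x,+,-}\{X_1(y)\neq X_2(y)\}$ (so $D^\sigma_{x,x}=1$ and $D^\sigma_{x,y}=0$ for $y\in(<x)$). *)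

theory Defs
  imports "HOL-Probability.Probability"
begin

(* The spins + and - are True and False, so that flipping a spin is negation.
   Every type is nonempty, hence CARD('d) >= 1. *)
type_synonym 'd site = "int ^ 'd"
type_synonym 'd config = "'d site \<Rightarrow> bool"

definition config_algebra :: "('d::finite) config measure" where
  "config_algebra = (\<Pi>\<^sub>M x\<in>UNIV. count_space UNIV)"

(* The sigma-algebra on the whole configuration space generated by the coordinates in L. *)
definition coord_algebra :: "('d::finite) site set \<Rightarrow> 'd config measure" where
  "coord_algebra L =
     vimage_algebra UNIV (\<lambda>\<sigma>. restrict \<sigma> L) (\<Pi>\<^sub>M x\<in>L. count_space UNIV)"

definition sup_radius :: "('d::finite) site \<Rightarrow> int" where
  "sup_radius x = Max (range (\<lambda>i. \<bar>x $ i\<bar>))"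

(* The order inside a shell is left free: no particular spiral in dimension d is singled out. *)
definition spiraling_enumeration :: "(('d::finite) site \<Rightarrow> nat) \<Rightarrow> bool" where
  "spiraling_enumeration \<Gamma> \<longleftrightarrow>
     bij_betw \<Gamma> UNIV {1..} \<and> \<Gamma> 0 = 1 \<and>
     (\<forall>x y. sup_radius x < sup_radius y \<longrightarrow> \<Gamma> x < \<Gamma> y)"

definition sites_upto :: "(('d::finite) site \<Rightarrow> nat) \<Rightarrow> 'd site \<Rightarrow> 'd site set" where
  "sites_upto \<Gamma> x = {y. \<Gamma> y \<le> \<Gamma> x}"

(* A version of the conditional measures given the coordinates up to x, chosen such that for
   every \<sigma> (also where the conditioning is degenerate) it lives on the configurations
   that equal \<sigma> up to x. Being measurable for the coordinates up to x, \<kappa> \<sigma>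
   depends on \<sigma> only through them; the measure conditioned on \<sigma> below x and on
   the spin s at x is \<kappa> (\<sigma>(x := s)). *)
definition conditional_version ::
  "(('d::finite) site \<Rightarrow> nat) \<Rightarrow> 'd config measure \<Rightarrow> 'd site
     \<Rightarrow> ('d config \<Rightarrow> 'd config measure) \<Rightarrow> bool" where
  "conditional_version \<Gamma> P x \<kappa> \<longleftrightarrow>
     \<kappa> \<in> coord_algebra (sites_upto \<Gamma> x) \<rightarrow>\<^sub>M prob_algebra config_algebra \<and>
     (\<forall>A\<in>sets config_algebra. AE \<sigma> in P.
        measure (\<kappa> \<sigma>) A =
          real_cond_exp P (coord_algebra (sites_upto \<Gamma> x)) (indicator A) \<sigma>) \<and>
     (\<forall>\<sigma>. AE \<eta> in \<kappa> \<sigma>. \<forall>y\<in>sites_upto \<Gamma> x. \<eta> y = \<sigma> y)"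

definition coupling ::
  "('d::finite) config measure \<Rightarrow> 'd config measure
     \<Rightarrow> ('d config \<times> 'd config) measure \<Rightarrow> bool" where
  "coupling \<mu> \<nu> Q \<longleftrightarrow>
     prob_space Q \<and> sets Q = sets (config_algebra \<Otimes>\<^sub>M config_algebra) \<and>
     distr Q config_algebra fst = \<mu> \<and> distr Q config_algebra snd = \<nu>"

definition agree_off :: "('d::finite) site set \<Rightarrow> ('d config \<times> 'd config) set" where
  "agree_off L = {(\<eta>, \<zeta>). \<forall>y. y \<notin> L \<longrightarrow> \<eta> y = \<zeta> y}"

definition maximal_coupling ::
  "('d::finite) site set \<Rightarrow> 'd config measure \<Rightarrow> 'd config measure
     \<Rightarrow> ('d config \<times> 'd config) measure \<Rightarrow> bool" where
  "maximal_coupling L \<mu> \<nu> Q \<longleftrightarrow>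
     coupling \<mu> \<nu> Q \<and>
     (\<forall>Q'. coupling \<mu> \<nu> Q' \<longrightarrow> measure Q' (agree_off L) \<le> measure Q (agree_off L))"

definition coupling_matrix ::
  "(('d::finite) site \<Rightarrow> 'd config \<Rightarrow> ('d config \<times> 'd config) measure)
     \<Rightarrow> 'd config \<Rightarrow> 'd site \<Rightarrow> 'd site \<Rightarrow> real" where
  "coupling_matrix Q \<sigma> x y = measure (Q x \<sigma>) {(\<eta>, \<zeta>). \<eta> y \<noteq> \<zeta> y}"

definition moment_matrix ::
  "('d::finite) config measure \<Rightarrow> ('d config \<Rightarrow> 'd site \<Rightarrow> 'd site \<Rightarrow> real) \<Rightarrow> nat
     \<Rightarrow> 'd site \<Rightarrow> 'd site \<Rightarrow> real" where
  "moment_matrix P D q x y = root q (\<integral>\<sigma>. D \<sigma> x y ^ q \<partial>P)"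

definition local_function :: "(('d::finite) config \<Rightarrow> real) \<Rightarrow> bool" where
  "local_function g \<longleftrightarrow>
     (\<exists>L. finite L \<and> (\<forall>\<sigma> \<tau>. (\<forall>x\<in>L. \<sigma> x = \<tau> x) \<longrightarrow> g \<sigma> = g \<tau>))"

definition flip :: "('d::finite) site \<Rightarrow> 'd config \<Rightarrow> 'd config" where
  "flip x \<sigma> = \<sigma>(x := \<not> \<sigma> x)"

(* The supremum is finite for local g, which take only finitely many values. *)
definition variation :: "(('d::finite) config \<Rightarrow> real) \<Rightarrow> 'd site \<Rightarrow> real" where
  "variation g x = (SUP \<sigma>. \<bar>g (flip x \<sigma>) - g \<sigma>\<bar>)"

definition ell2 :: "('a \<Rightarrow> real) set" where
  "ell2 = {v. (\<lambda>x. (v x)\<^sup>2) summable_on UNIV}"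

definition ell2_norm :: "('a \<Rightarrow> real) \<Rightarrow> real" where
  "ell2_norm v = sqrt (\<Sum>\<^sub>\<infinity>x. (v x)\<^sup>2)"

definition mat_apply :: "('a \<Rightarrow> 'a \<Rightarrow> real) \<Rightarrow> ('a \<Rightarrow> real) \<Rightarrow> 'a \<Rightarrow> real" where
  "mat_apply M v x = (\<Sum>\<^sub>\<infinity>y. M x y * v y)"

(* The least bound of M as an operator on ell2; the infimum over the empty set is \<infinity>,
   which covers every M that does not define a bounded operator on ell2. *)
definition ell2_opnorm :: "('a \<Rightarrow> 'a \<Rightarrow> real) \<Rightarrow> ennreal" where
  "ell2_opnorm M =
     (INF C\<in>{C. 0 \<le> C \<and>
        (\<forall>v\<in>ell2. (\<forall>x. (\<lambda>y. M x y * v y) summable_on UNIV) \<and>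
           mat_apply M v \<in> ell2 \<and> ell2_norm (mat_apply M v) \<le> C * ell2_norm v)}.
      ennreal C)"

end

theory Submission
  imports Defs
begin

text \<open>
  Reveal the spins one by one along the enumeration. The increment of the martingale
  \<open>E[g | first n spins]\<close> is bounded by the difference of the two conditional expectations of \<open>g\<close>
  given \<open>+\<close> or \<open>-\<close> at the new site \<open>x\<close>, hence, through the coupling, by \<open>\<Sum>y. D x y * \<delta> y\<close>, whose
  \<open>2p\<close>-norm is at most \<open>w x = \<Sum>y. \<D> x y * \<delta> y\<close> by Minkowski. Instead of Burkholder's inequality,
  the even moments of the martingale are controlled by the elementary bound
  \<open>(m + v)^(2p) \<le> 2p m^(2p - 1) v + (m\<^sup>2 + 8p v\<^sup>2)^p\<close>: the linear term has mean zero, and Minkowski in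
  \<open>L^p\<close> gives \<open>E (g - E g)^(2p) \<le> (8p \<Sum>x. (w x)\<^sup>2)^p\<close>, where \<open>8p \<le> (20p)\<^sup>2\<close>.
\<close>

section \<open>Even moments of martingales\<close>

lemma convex_on_power_nonneg: "convex_on {0::real..} (\<lambda>x. x ^ n)"
proof (cases "even n")
  case True
  then show ?thesis
    using convex_power_even convex_on_subset by (metis subset_UNIV convex_real_interval(1))
qed (rule convex_power_odd)

text \<open>One more factor mixes the parts that are even and odd in \<open>y\<close>, so both
  bounds have to be carried through the induction together. The constant \<open>c\<close> is kept
  apart from \<open>n\<close> so that \<open>r\<close> stays fixed while \<open>n\<close>
  grows.\<close>

lemma even_and_odd_part_power_le:
  fixes x y c r :: real
  assumes "0 \<le> x" "0 \<le> y" "0 < r" "r\<^sup>2 = x\<^sup>2 + c * y\<^sup>2" "2 * real n \<le> c"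
  shows "(x + y) ^ n + (x - y) ^ n \<le> 2 * r ^ n \<and>
         r * ((x + y) ^ n - (x - y) ^ n) \<le> 2 * real n * y * r ^ n"
  using assms(5)
proof (induction n)
  case 0
  then show ?case by simp
next
  case (Suc n)
  define S T where "S = (x + y) ^ n + (x - y) ^ n" and "T = (x + y) ^ n - (x - y) ^ n"
  have S: "S \<le> 2 * r ^ n" and T: "r * T \<le> 2 * real n * y * r ^ n"
    using Suc by (auto simp: S_def T_def)
  have S': "(x + y) ^ Suc n + (x - y) ^ Suc n = x * S + y * T"
    and T': "(x + y) ^ Suc n - (x - y) ^ Suc n = x * T + y * S"
    by (simp_all add: S_def T_def algebra_simps)
  have c: "0 \<le> c" using Suc.prems by simp
  have xr: "x \<le> r"
    by (rule power2_le_imp_le) (use assms(3) c in \<open>simp_all add: assms(4)\<close>)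
  \<comment> \<open>Since \<open>r^2 - x^2 = (r + x) * (r - x)\<close> and \<open>x \<le> r\<close>,
    the term \<open>c * y^2\<close> is at most \<open>2 * r * (r - x)\<close>; halving this gives
    \<open>key\<close>, which closes both halves of the induction.\<close>
  have "real n * y\<^sup>2 * 2 \<le> c * y\<^sup>2"
    using mult_right_mono[of "2 * real n" c "y\<^sup>2"] Suc.prems by (simp add: mult_ac)
  also have "c * y\<^sup>2 = (r + x) * (r - x)"
    using assms(4) by (simp add: algebra_simps power2_eq_square)
  also have "\<dots> \<le> (2 * r) * (r - x)"
    using xr by (intro mult_right_mono) auto
  finally have key: "r * x + real n * y\<^sup>2 \<le> r * r"
    by (simp add: algebra_simps)
  have "r * (x * S + y * T) = (r * x) * S + y * (r * T)"
    by (simp add: algebra_simps)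
  also have "\<dots> \<le> (r * x) * (2 * r ^ n) + y * (2 * real n * y * r ^ n)"
    using S T assms by (intro add_mono mult_left_mono) auto
  also have "\<dots> = 2 * r ^ n * (r * x + real n * y\<^sup>2)"
    by (simp add: algebra_simps power2_eq_square)
  also have "\<dots> \<le> 2 * r ^ n * (r * r)"
    using key assms by (intro mult_left_mono) auto
  also have "\<dots> = r * (2 * r ^ Suc n)"
    by simp
  finally have 1: "x * S + y * T \<le> 2 * r ^ Suc n"
    using assms by simp
  have "r * (x * T + y * S) = x * (r * T) + r * y * S"
    by (simp add: algebra_simps)
  also have "\<dots> \<le> x * (2 * real n * y * r ^ n) + r * y * (2 * r ^ n)"
    using S T assms by (intro add_mono mult_left_mono) auto
  also have "\<dots> \<le> r * (2 * real n * y * r ^ n) + r * y * (2 * r ^ n)"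
    using xr assms by (intro add_mono mult_right_mono) auto
  also have "\<dots> = 2 * real (Suc n) * y * r ^ Suc n"
    by (simp add: algebra_simps)
  finally show ?case
    unfolding S' T' using 1 by simp
qed

text \<open>The exponent \<open>2 * p\<close> allows \<open>c = 4 * p\<close> in the previous lemma.
  Passing to absolute values at most swaps the two even powers, so their sum is unchanged.\<close>

lemma even_part_power_le:
  fixes x y :: real
  shows "(x + y) ^ (2 * p) + (x - y) ^ (2 * p) \<le> 2 * (x\<^sup>2 + 4 * real p * y\<^sup>2) ^ p"
\<comment> \<open>Splitting off these cases leaves a positive radicand, as \<open>r > 0\<close> is
  required below.\<close>
proof (cases "y = 0 \<or> p = 0")
  case True
  then show ?thesis by (auto simp: power_mult)
next
  case False
  define r where "r = sqrt (x\<^sup>2 + 4 * real p * y\<^sup>2)"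
  have pos: "0 < x\<^sup>2 + 4 * real p * y\<^sup>2"
    using False by (intro add_nonneg_pos mult_pos_pos) auto
  then have r: "0 < r" "r\<^sup>2 = \<bar>x\<bar>\<^sup>2 + 4 * real p * \<bar>y\<bar>\<^sup>2"
    by (auto simp: r_def)
  have "(\<bar>x\<bar> + \<bar>y\<bar>) ^ (2 * p) + (\<bar>x\<bar> - \<bar>y\<bar>) ^ (2 * p) \<le> 2 * r ^ (2 * p)"
    using even_and_odd_part_power_le[OF _ _ r, of "2 * p"] by simp
  moreover have "(\<bar>x\<bar> + \<bar>y\<bar>)\<^sup>2 = (x + y)\<^sup>2 \<and> (\<bar>x\<bar> - \<bar>y\<bar>)\<^sup>2 = (x - y)\<^sup>2 \<or>
      (\<bar>x\<bar> + \<bar>y\<bar>)\<^sup>2 = (x - y)\<^sup>2 \<and> (\<bar>x\<bar> - \<bar>y\<bar>)\<^sup>2 = (x + y)\<^sup>2"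
    by (auto simp: abs_if power2_eq_square algebra_simps)
  moreover have "r\<^sup>2 = x\<^sup>2 + 4 * real p * y\<^sup>2"
    using r by simp
  ultimately show ?thesis
    by (auto simp: power_mult)
qed

text \<open>An even power lies above its tangent at \<open>x\<close>. After division by
  \<open>x ^ (2 * p)\<close> this is Bernoulli's inequality at \<open>- y / x\<close>, which for an
  even exponent holds without a lower bound on the argument.\<close>

lemma power_tangent_even:
  fixes x y :: real
  assumes "1 \<le> p"
  shows "x ^ (2 * p) - 2 * real p * x ^ (2 * p - 1) * y \<le> (x - y) ^ (2 * p)"
proof (cases "x = 0")
  case True
  then show ?thesis using assms by (simp add: power_0_left zero_le_even_power)
next
  case False
  have "1 + real (2 * p) * (- y / x) \<le> (1 + - y / x) ^ (2 * p)"
    by (rule Bernoulli_inequality_even) simp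
  then have "x ^ (2 * p) * (1 + real (2 * p) * (- y / x)) \<le> x ^ (2 * p) * (1 + - y / x) ^ (2 * p)"
    by (rule mult_left_mono) (simp add: zero_le_even_power)
  also have "\<dots> = (x - y) ^ (2 * p)"
    using False by (simp add: divide_simps flip: power_mult_distrib) (simp add: algebra_simps)
  also have "x ^ (2 * p) * (1 + real (2 * p) * (- y / x)) = x ^ (2 * p) - 2 * real p * (x ^ (2 * p) / x) * y"
    by (simp add: algebra_simps)
  also have "x ^ (2 * p) / x = x ^ (2 * p - 1)"
    using False assms by (simp add: power_diff)
  finally show ?thesis .
qed

text \<open>The term linear in \<open>y\<close> is kept exactly, because it vanishes in expectation for a martingale increment.\<close>

lemma power_add_even_le:
  fixes x y :: real
  assumes "1 \<le> p"
  shows "(x + y) ^ (2 * p) \<le> 2 * real p * x ^ (2 * p - 1) * y + (x\<^sup>2 + 8 * real p * y\<^sup>2) ^ p"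
proof -
  \<comment> \<open>Here \<open>x^2 + 4 * p * y^2\<close> is the midpoint of \<open>x^2\<close> and
    \<open>x^2 + 8 * p * y^2\<close>. Convexity thus doubles the constant but splits off a summand
    \<open>x ^ (2 * p)\<close>, which cancels against the one in the tangent inequality for
    \<open>(x - y) ^ (2 * p)\<close>.\<close>
  have "((1 - 1 / 2) *\<^sub>R x\<^sup>2 + (1 / 2) *\<^sub>R (x\<^sup>2 + 8 * real p * y\<^sup>2)) ^ p
      \<le> (1 - 1 / 2) * (x\<^sup>2) ^ p + (1 / 2) * (x\<^sup>2 + 8 * real p * y\<^sup>2) ^ p"
    by (intro convex_onD[OF convex_on_power_nonneg]) auto
  also have "(x\<^sup>2) ^ p = x ^ (2 * p)"
    by (simp add: power_mult)
  finally have "2 * (x\<^sup>2 + 4 * real p * y\<^sup>2) ^ p \<le> x ^ (2 * p) + (x\<^sup>2 + 8 * real p * y\<^sup>2) ^ p"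
    by (simp add: algebra_simps)
  with even_part_power_le[of x y p] power_tangent_even[OF assms, of x y] show ?thesis
    by linarith
qed

section \<open>Minkowski's inequality and a single martingale step\<close>

text \<open>Minkowski's inequality in \<open>L^n\<close>, stated without roots. It follows from
  convexity of the power at \<open>f / c\<close> and \<open>g / d\<close> with weights proportional
  to \<open>c\<close> and \<open>d\<close>.\<close>

lemma integral_power_add_le:
  fixes f g :: "'a \<Rightarrow> real"
  assumes int: "integrable M (\<lambda>x. f x ^ n)" "integrable M (\<lambda>x. g x ^ n)"
      "integrable M (\<lambda>x. (f x + g x) ^ n)"
    and nonneg: "\<And>x. 0 \<le> f x" "\<And>x. 0 \<le> g x" "0 \<le> a" "0 \<le> b"
    and le: "(\<integral>x. f x ^ n \<partial>M) \<le> a ^ n" "(\<integral>x. g x ^ n \<partial>M) \<le> b ^ n"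
  shows "(\<integral>x. (f x + g x) ^ n \<partial>M) \<le> (a + b) ^ n"
proof -
  \<comment> \<open>Normalising by the norms needs strictly positive bounds, so \<open>a\<close> and
    \<open>b\<close> are first replaced by larger positive numbers.\<close>
  have pos: "(\<integral>x. (f x + g x) ^ n \<partial>M) \<le> (c + d) ^ n"
    if "0 < c" "0 < d" "a \<le> c" "b \<le> d" for c d
  proof -
    define t where "t = d / (c + d)"
    have t: "0 \<le> t" "t \<le> 1" "1 - t = c / (c + d)"
      using that by (auto simp: t_def field_simps)
    have pw: "(f x + g x) ^ n \<le> (c + d) ^ n * ((1 - t) * (f x ^ n / c ^ n) + t * (g x ^ n / d ^ n))" for x
    proof -
      have "((1 - t) *\<^sub>R (f x / c) + t *\<^sub>R (g x / d)) ^ n \<le> (1 - t) * (f x / c) ^ n + t * (g x / d) ^ n"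
        using t that nonneg by (intro convex_onD[OF convex_on_power_nonneg]) auto
      moreover have "(1 - t) *\<^sub>R (f x / c) + t *\<^sub>R (g x / d) = (f x + g x) / (c + d)"
        unfolding t using that by (simp add: t_def add_divide_distrib)
      ultimately have "(f x + g x) ^ n / (c + d) ^ n \<le> (1 - t) * (f x ^ n / c ^ n) + t * (g x ^ n / d ^ n)"
        by (simp add: power_divide)
      then show ?thesis
        using that by (simp add: divide_le_eq mult.commute)
    qed
    have "(\<integral>x. (f x + g x) ^ n \<partial>M)
        \<le> (\<integral>x. (c + d) ^ n * ((1 - t) * (f x ^ n / c ^ n) + t * (g x ^ n / d ^ n)) \<partial>M)"
      using int pw by (intro integral_mono) auto
    also have "\<dots> = (c + d) ^ n * ((1 - t) * ((\<integral>x. f x ^ n \<partial>M) / c ^ n) + t * ((\<integral>x. g x ^ n \<partial>M) / d ^ n))"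
      using int by simp
    also have "\<dots> \<le> (c + d) ^ n * ((1 - t) * 1 + t * 1)"
    proof (intro mult_left_mono add_mono)
      have "(\<integral>x. f x ^ n \<partial>M) \<le> c ^ n" "(\<integral>x. g x ^ n \<partial>M) \<le> d ^ n"
        using le that nonneg power_mono[of a c n] power_mono[of b d n] by linarith+
      then show "(\<integral>x. f x ^ n \<partial>M) / c ^ n \<le> 1" "(\<integral>x. g x ^ n \<partial>M) / d ^ n \<le> 1"
        using that by auto
    qed (use t that in auto)
    finally show ?thesis by simp
  qed
  \<comment> \<open>The bounds \<open>a + e\<close> and \<open>b + e\<close> are admissible above,
    and \<open>e\<close> tends to 0 from the right.\<close>
  have "((\<lambda>e. (a + e + (b + e)) ^ n) \<longlongrightarrow> (a + 0 + (b + 0)) ^ n) (at_right 0)"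
    by (intro tendsto_intros)
  moreover have "\<forall>\<^sub>F e in at_right 0. (\<integral>x. (f x + g x) ^ n \<partial>M) \<le> (a + e + (b + e)) ^ n"
  proof (rule eventually_at_rightI[of 0 1])
    fix e :: real
    assume "e \<in> {0<..<1}"
    then show "(\<integral>x. (f x + g x) ^ n \<partial>M) \<le> (a + e + (b + e)) ^ n"
      using nonneg by (intro pos) auto
  qed simp
  ultimately show ?thesis
    by (auto dest!: tendsto_lowerbound)
qed

lemma (in finite_measure) integrable_bounded:
  fixes f :: "'a \<Rightarrow> real"
  assumes "f \<in> borel_measurable M" "\<And>x. \<bar>f x\<bar> \<le> B"
  shows "integrable M f"
  using assms by (intro integrable_const_bound[where B = B]) auto

lemma (in finite_measure) integrable_power_bounded:
  fixes f :: "'a \<Rightarrow> real"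
  assumes "f \<in> borel_measurable M" "\<And>x. \<bar>f x\<bar> \<le> B"
  shows "integrable M (\<lambda>x. f x ^ n)"
  using assms by (intro integrable_bounded[where B = "B ^ n"]) (auto simp: power_abs intro!: power_mono)

lemma (in finite_measure) integral_power_sum_le:
  fixes f :: "'i \<Rightarrow> 'a \<Rightarrow> real"
  assumes "finite I" "1 \<le> n"
    and meas: "\<And>i. i \<in> I \<Longrightarrow> f i \<in> borel_measurable M"
    and bnd: "\<And>i x. i \<in> I \<Longrightarrow> 0 \<le> f i x" "\<And>i x. i \<in> I \<Longrightarrow> f i x \<le> B i"
    and le: "\<And>i. i \<in> I \<Longrightarrow> (\<integral>x. f i x ^ n \<partial>M) \<le> a i ^ n" "\<And>i. i \<in> I \<Longrightarrow> 0 \<le> a i"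
  shows "(\<integral>x. (\<Sum>i\<in>I. f i x) ^ n \<partial>M) \<le> (\<Sum>i\<in>I. a i) ^ n"
  using assms(1) meas bnd le
proof (induction I rule: finite_induct)
  case empty
  then show ?case using \<open>1 \<le> n\<close> by (simp add: power_0_left)
next
  case (insert j I)
  \<comment> \<open>The uniform bound yields the integrability that the two-function inequality asks
    of both summands and of their sum.\<close>
  have bs: "\<bar>\<Sum>i\<in>J. f i x\<bar> \<le> (\<Sum>i\<in>J. B i)" if "J \<subseteq> insert j I" for J x
    using that insert.prems(2,3) by (subst abs_of_nonneg) (auto intro!: sum_nonneg sum_mono)
  have "integrable M (\<lambda>x. (\<Sum>i\<in>J. f i x) ^ n)" if "J \<subseteq> insert j I" for J
    by (rule integrable_power_bounded[OF _ bs[OF that]])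
      (use that insert.prems(1) in \<open>auto intro!: borel_measurable_sum\<close>)
  from this[of "{j}"] this[of I] this[of "insert j I"] show ?case
    using insert by (auto intro!: integral_power_add_le sum_nonneg)
qed

text \<open>\<open>W\<close> is the centred martingale so far, \<open>V\<close> its next increment
  and \<open>U\<close> a dominating function. Since \<open>A\<close> bounds the square of the
  \<open>2p\<close>-norm of \<open>W\<close>, squared norms add up over the steps, each increment
  being charged the factor \<open>8 * p\<close>.\<close>

lemma (in prob_space) martingale_step_moment_le:
  fixes W V U :: "'a \<Rightarrow> real"
  assumes p: "1 \<le> p"
    and [measurable]: "W \<in> borel_measurable M" "V \<in> borel_measurable M" "U \<in> borel_measurable M"
    and B: "\<And>x. \<bar>W x\<bar> \<le> B" "\<And>x. \<bar>V x\<bar> \<le> B" "\<And>x. \<bar>U x\<bar> \<le> B"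
    and orth: "(\<integral>x. W x ^ (2 * p - 1) * V x \<partial>M) = 0"
    and VU: "AE x in M. \<bar>V x\<bar> \<le> U x"
    and U: "(\<integral>x. U x ^ (2 * p) \<partial>M) \<le> w ^ (2 * p)" "0 \<le> w"
    and W: "(\<integral>x. W x ^ (2 * p) \<partial>M) \<le> A ^ p" "0 \<le> A"
  shows "(\<integral>x. (W x + V x) ^ (2 * p) \<partial>M) \<le> (A + 8 * real p * w\<^sup>2) ^ p"
proof -
  have B0: "0 \<le> B" using B(1) abs_ge_zero order_trans by blast
  have sq: "z\<^sup>2 \<le> B\<^sup>2" if "\<bar>z\<bar> \<le> B" for z :: real
    using power_mono[OF that abs_ge_zero, of 2] by simp
  have i1: "integrable M (\<lambda>x. (W x + V x) ^ (2 * p))"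
  proof (rule integrable_power_bounded)
    show "\<bar>W x + V x\<bar> \<le> B + B" for x
      using B(1)[of x] B(2)[of x] by linarith
  qed simp
  have i2: "integrable M (\<lambda>x. W x ^ (2 * p - 1) * V x)"
    by (rule integrable_bounded[where B = "B ^ (2 * p - 1) * B"])
      (auto simp: abs_mult power_abs intro!: mult_mono power_mono zero_le_power B B0)
  have i3: "integrable M (\<lambda>x. ((W x)\<^sup>2 + 8 * real p * (U x)\<^sup>2) ^ p)"
    by (rule integrable_power_bounded[where B = "B\<^sup>2 + 8 * real p * B\<^sup>2"])
      (auto intro!: add_mono mult_left_mono sq B)
  have i4: "integrable M (\<lambda>x. ((W x)\<^sup>2) ^ p)"
    by (rule integrable_power_bounded[where B = "B\<^sup>2"]) (auto intro!: sq B)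
  have i5: "integrable M (\<lambda>x. (8 * real p * (U x)\<^sup>2) ^ p)"
    by (rule integrable_power_bounded[where B = "8 * real p * B\<^sup>2"])
      (auto intro!: mult_left_mono sq B)
  have "(\<integral>x. (W x + V x) ^ (2 * p) \<partial>M)
      \<le> (\<integral>x. 2 * real p * (W x ^ (2 * p - 1) * V x) + ((W x)\<^sup>2 + 8 * real p * (U x)\<^sup>2) ^ p \<partial>M)"
  proof (rule integral_mono_AE)
    show "AE x in M. (W x + V x) ^ (2 * p)
        \<le> 2 * real p * (W x ^ (2 * p - 1) * V x) + ((W x)\<^sup>2 + 8 * real p * (U x)\<^sup>2) ^ p"
      using VU
    proof eventually_elim
      case (elim x)
      have "(V x)\<^sup>2 \<le> (U x)\<^sup>2"
        using elim by (simp add: abs_le_square_iff[symmetric])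
      then have "((W x)\<^sup>2 + 8 * real p * (V x)\<^sup>2) ^ p \<le> ((W x)\<^sup>2 + 8 * real p * (U x)\<^sup>2) ^ p"
        by (intro power_mono[where n = p] add_left_mono mult_left_mono) simp_all
      with power_add_even_le[OF p, of "W x" "V x"] show ?case
        by (simp add: mult.assoc)
    qed
  qed (use i1 i2 i3 in auto)
  also have "\<dots> = (\<integral>x. ((W x)\<^sup>2 + 8 * real p * (U x)\<^sup>2) ^ p \<partial>M)"
    using i2 i3 orth by simp
  \<comment> \<open>Minkowski is applied with exponent \<open>p\<close> to the squares, whose
    \<open>L^p\<close> norms are squares of \<open>2p\<close>-norms.\<close>
  also have "\<dots> \<le> (A + 8 * real p * w\<^sup>2) ^ p"
  proof (rule integral_power_add_le[OF i4 i5 i3])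
    show "(\<integral>x. ((W x)\<^sup>2) ^ p \<partial>M) \<le> A ^ p"
      using W by (simp add: power_mult)
    have "(8 * real p) ^ p * (\<integral>x. U x ^ (2 * p) \<partial>M) \<le> (8 * real p) ^ p * w ^ (2 * p)"
      using U by (intro mult_left_mono) auto
    then show "(\<integral>x. (8 * real p * (U x)\<^sup>2) ^ p \<partial>M) \<le> (8 * real p * w\<^sup>2) ^ p"
      by (simp add: power_mult power_mult_distrib)
  qed (use W U in auto)
  finally show ?thesis .
qed

section \<open>Local functions on the configuration space\<close>

lemma space_config_algebra [simp]: "space config_algebra = UNIV"
  by (simp add: config_algebra_def space_PiM)

lemma space_coord_algebra [simp]: "space (coord_algebra L) = UNIV"
  by (simp add: coord_algebra_def)

lemma measurable_config_component: "(\<lambda>\<sigma>. \<sigma> y) \<in> config_algebra \<rightarrow>\<^sub>M count_space UNIV"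
  unfolding config_algebra_def by (rule measurable_component_singleton) simp

lemma measurable_into_coord_algebra:
  assumes "\<And>y. y \<in> L \<Longrightarrow> (\<lambda>\<sigma>. f \<sigma> y) \<in> N \<rightarrow>\<^sub>M count_space UNIV"
  shows "f \<in> N \<rightarrow>\<^sub>M coord_algebra L"
  unfolding coord_algebra_def
proof (rule measurable_vimage_algebra2)
  show "(\<lambda>\<sigma>. restrict (f \<sigma>) L) \<in> N \<rightarrow>\<^sub>M (\<Pi>\<^sub>M x\<in>L. count_space UNIV)"
    using assms by (rule measurable_restrict)
qed simp

lemma measurable_restrict_coord_algebra:
  "(\<lambda>\<sigma>. restrict \<sigma> L) \<in> coord_algebra L \<rightarrow>\<^sub>M (\<Pi>\<^sub>M x\<in>L. count_space UNIV)"
  unfolding coord_algebra_def by (rule measurable_vimage_algebra1) (auto simp: space_PiM)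

lemma measurable_coord_component:
  assumes "y \<in> L"
  shows "(\<lambda>\<sigma>. \<sigma> y) \<in> coord_algebra L \<rightarrow>\<^sub>M count_space UNIV"
proof -
  have "(\<lambda>\<sigma>. restrict \<sigma> L y) \<in> coord_algebra L \<rightarrow>\<^sub>M count_space UNIV"
    using assms by (intro measurable_compose[OF measurable_restrict_coord_algebra measurable_component_singleton])
  then show ?thesis using assms by simp
qed

lemma subalgebraI_ident:
  assumes "space F = space M" "(\<lambda>x. x) \<in> M \<rightarrow>\<^sub>M F"
  shows "subalgebra M F"
  unfolding subalgebra_def
proof (intro conjI subsetI)
  fix A assume "A \<in> sets F"
  then have "(\<lambda>x. x) -` A \<inter> space M = A"
    using sets.sets_into_space[of A F] assms(1) by auto
  then show "A \<in> sets M"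
    using measurable_sets[OF assms(2) \<open>A \<in> sets F\<close>] by simp
qed (rule assms(1))

lemma subalgebra_config_coord: "subalgebra config_algebra (coord_algebra L)"
  by (intro subalgebraI_ident measurable_into_coord_algebra measurable_config_component) simp

lemma subalgebra_coord_mono: "L \<subseteq> L' \<Longrightarrow> subalgebra (coord_algebra L') (coord_algebra L)"
  by (intro subalgebraI_ident measurable_into_coord_algebra measurable_coord_component) auto

text \<open>Before any spin is revealed the sigma-algebra is trivial, so a constant can serve as the
  conditional expectation at time 0.\<close>

lemma sets_coord_algebra_empty: "sets (coord_algebra {}) = {{}, UNIV}"
proof -
  have "sets (coord_algebra {}) = {(\<lambda>\<sigma>. restrict \<sigma> {}) -` A \<inter> UNIV |A. A \<in> {{}, {\<lambda>_. undefined}}}"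
    unfolding coord_algebra_def by (subst sets_vimage_algebra2) (auto simp: space_PiM sets_PiM_empty)
  also have "\<dots> = (\<lambda>A. (\<lambda>\<sigma>. restrict \<sigma> {}) -` A \<inter> UNIV) ` {{}, {\<lambda>_. undefined}}"
    by blast
  also have "\<dots> = {{}, UNIV}"
    by (simp add: restrict_def)
  finally show ?thesis .
qed

text \<open>A finite product of discrete spin spaces is discrete, so every function on it is
  measurable, and \<open>g\<close> factors through the restriction to \<open>L\<close>.\<close>

lemma borel_measurable_coord_algebra:
  fixes g :: "('d::finite) config \<Rightarrow> real"
  assumes "finite L" and dep: "\<And>\<sigma> \<tau>. (\<And>x. x \<in> L \<Longrightarrow> \<sigma> x = \<tau> x) \<Longrightarrow> g \<sigma> = g \<tau>"
  shows "g \<in> borel_measurable (coord_algebra L)"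
proof -
  have "(\<Pi>\<^sub>M x\<in>L. count_space (UNIV :: bool set)) = count_space (PiE L (\<lambda>_. UNIV))"
    by (intro count_space_PiM_finite assms(1)) auto
  then have "(\<lambda>\<sigma>. g (restrict \<sigma> L)) \<in> borel_measurable (coord_algebra L)"
    using measurable_restrict_coord_algebra[of L]
    by (intro measurable_compose[of "\<lambda>\<sigma>. restrict \<sigma> L" _ "count_space (PiE L (\<lambda>_. UNIV))" g]) simp_all
  also have "(\<lambda>\<sigma>. g (restrict \<sigma> L)) = g"
    by (intro ext dep) simp
  finally show ?thesis .
qed

section \<open>Finite range, variation and changing one spin at a time\<close>

lemma finite_range_local:
  fixes g :: "('d::finite) config \<Rightarrow> real"
  assumes "finite L" and dep: "\<And>\<sigma> \<tau>. (\<And>x. x \<in> L \<Longrightarrow> \<sigma> x = \<tau> x) \<Longrightarrow> g \<sigma> = g \<tau>"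
  shows "finite (range g)"
proof (rule finite_subset)
  show "range g \<subseteq> (\<lambda>S. g (\<lambda>x. x \<in> S)) ` Pow L"
  proof
    fix r assume "r \<in> range g"
    then obtain \<sigma> where "r = g \<sigma>" by auto
    also have "g \<sigma> = g (\<lambda>x. x \<in> {x \<in> L. \<sigma> x})"
      by (rule dep) simp
    finally show "r \<in> (\<lambda>S. g (\<lambda>x. x \<in> S)) ` Pow L"
      by blast
  qed
qed (use assms(1) in simp)

text \<open>A finite range makes the set under the supremum bounded above, so that the real supremum
  is a genuine upper bound.\<close>

lemma variation_ge:
  fixes g :: "('d::finite) config \<Rightarrow> real"
  assumes "finite (range g)"
  shows "\<bar>g (flip x \<sigma>) - g \<sigma>\<bar> \<le> variation g x"
  unfolding variation_def
proof (rule cSUP_upper)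
  have "finite ((\<lambda>(a, b). \<bar>a - b\<bar>) ` (range g \<times> range g))"
    using assms by simp
  then show "bdd_above (range (\<lambda>\<sigma>. \<bar>g (flip x \<sigma>) - g \<sigma>\<bar>))"
    by (intro bdd_above_finite) (rule finite_subset, auto)
qed simp

lemma variation_nonneg: "finite (range g) \<Longrightarrow> 0 \<le> variation g x"
  using variation_ge[of g x] abs_ge_zero order_trans by blast

lemma variation_eq_0_off:
  fixes g :: "('d::finite) config \<Rightarrow> real"
  assumes "\<And>\<sigma> \<tau>. (\<And>x. x \<in> L \<Longrightarrow> \<sigma> x = \<tau> x) \<Longrightarrow> g \<sigma> = g \<tau>" "x \<notin> L"
  shows "variation g x = 0"
proof -
  have "g (flip x \<sigma>) = g \<sigma>" for \<sigma>
    by (rule assms(1)) (use assms(2) in \<open>auto simp: flip_def\<close>)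
  then show ?thesis by (simp add: variation_def)
qed

text \<open>Turn \<open>\<zeta>\<close> into \<open>\<eta>\<close> site by site along
  \<open>L\<close>: a site of disagreement is a single flip and costs at most its variation, a site
  of agreement costs nothing.\<close>

lemma local_diff_le:
  fixes g :: "('d::finite) config \<Rightarrow> real"
  assumes "finite L" and dep: "\<And>\<sigma> \<tau>. (\<And>x. x \<in> L \<Longrightarrow> \<sigma> x = \<tau> x) \<Longrightarrow> g \<sigma> = g \<tau>"
  shows "\<bar>g \<eta> - g \<zeta>\<bar> \<le> (\<Sum>y\<in>L. of_bool (\<eta> y \<noteq> \<zeta> y) * variation g y)"
proof -
  define mix where "mix K = (\<lambda>y. if y \<in> K then \<eta> y else \<zeta> y)" for K
  have "\<bar>g (mix K) - g \<zeta>\<bar> \<le> (\<Sum>y\<in>K. of_bool (\<eta> y \<noteq> \<zeta> y) * variation g y)" if "finite K" for K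
    using that
  proof (induction K rule: finite_induct)
    case empty
    then show ?case by (simp add: mix_def)
  next
    case (insert y K)
    have "\<bar>g (mix (insert y K)) - g (mix K)\<bar> \<le> of_bool (\<eta> y \<noteq> \<zeta> y) * variation g y"
    proof (cases "\<eta> y = \<zeta> y")
      case True
      then have "mix (insert y K) = mix K"
        by (auto simp: mix_def)
      then show ?thesis by (simp add: True)
    next
      case False
      then have "mix (insert y K) = flip y (mix K)"
        using insert.hyps by (auto simp: mix_def flip_def fun_eq_iff)
      then show ?thesis
        using variation_ge[OF finite_range_local[of L g, OF assms], of y "mix K"] False by simp
    qed
    with insert.IH show ?case
      unfolding sum.insert[OF insert.hyps] by linarith
  qed
  moreover have "g (mix L) = g \<eta>"
    by (rule dep) (simp add: mix_def)
  ultimately show ?thesis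
    using assms(1) by metis
qed

text \<open>The versions of the conditional measures are characterised on events; this expansion
  carries that over to \<open>g\<close> by linearity.\<close>

lemma finite_range_expand:
  fixes g :: "'a \<Rightarrow> real"
  assumes "finite (range g)"
  shows "g = (\<lambda>\<tau>. \<Sum>v\<in>range g. v * indicator {\<tau>. g \<tau> = v} \<tau>)"
proof
  fix \<tau>
  have "(\<Sum>v\<in>range g. v * indicator {\<tau>. g \<tau> = v} \<tau>) = (\<Sum>v\<in>range g. if v = g \<tau> then v else 0)"
    by (intro sum.cong) (auto simp: indicator_def)
  also have "\<dots> = g \<tau>" using assms by simp
  finally show "g \<tau> = (\<Sum>v\<in>range g. v * indicator {\<tau>. g \<tau> = v} \<tau>)" by simp
qed

section \<open>The martingale of a coupled field\<close>

lemma integral_finite_range: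
  fixes g :: "'a \<Rightarrow> real"
  assumes "prob_space \<mu>" "finite (range g)" "\<And>v. {\<tau>. g \<tau> = v} \<in> sets \<mu>"
  shows "(\<integral>\<tau>. g \<tau> \<partial>\<mu>) = (\<Sum>v\<in>range g. v * measure \<mu> {\<tau>. g \<tau> = v})"
proof -
  interpret prob_space \<mu> by fact
  have "(\<integral>\<tau>. g \<tau> \<partial>\<mu>) = (\<integral>\<tau>. (\<Sum>v\<in>range g. v * indicator {\<tau>. g \<tau> = v} \<tau>) \<partial>\<mu>)"
    by (subst finite_range_expand[OF assms(2)]) simp
  also have "\<dots> = (\<Sum>v\<in>range g. v * measure \<mu> {\<tau>. g \<tau> = v})"
    using assms(3) by (subst Bochner_Integration.integral_sum) (auto simp: Int_absorb2 sets.sets_into_space emeasure_eq_measure)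
  finally show ?thesis .
qed

text \<open>Fixing a finite set \<open>L\<close> that determines \<open>g\<close> makes the sums
  over sites finite.\<close>

locale coupled_field = prob_space P for P :: "('d::finite) config measure" +
  fixes \<Gamma> :: "'d site \<Rightarrow> nat"
    and \<kappa> :: "'d site \<Rightarrow> 'd config \<Rightarrow> 'd config measure"
    and Q :: "'d site \<Rightarrow> 'd config \<Rightarrow> ('d config \<times> 'd config) measure"
    and g :: "'d config \<Rightarrow> real"
    and L :: "'d site set"
  assumes enumeration: "bij_betw \<Gamma> UNIV {1..}"
    and sets_P: "sets P = sets config_algebra"
    and version: "\<And>x. conditional_version \<Gamma> P x (\<kappa> x)"
    and couplings: "\<And>x \<sigma>. coupling (\<kappa> x (\<sigma>(x := True))) (\<kappa> x (\<sigma>(x := False))) (Q x \<sigma>)"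
    and measurable_coupling_matrix [measurable]:
      "\<And>x y. (\<lambda>\<sigma>. coupling_matrix Q \<sigma> x y) \<in> borel_measurable P"
    and finite_L: "finite L"
    and g_dep: "\<And>\<sigma> \<tau>. (\<And>x. x \<in> L \<Longrightarrow> \<sigma> x = \<tau> x) \<Longrightarrow> g \<sigma> = g \<tau>"
begin

definition "filt n = coord_algebra {y. \<Gamma> y \<le> n}"

definition "site_at n = inv \<Gamma> n"

text \<open>At \<open>n = 0\<close>, where \<open>site_at\<close> is junk because the enumeration starts at 1,
  the martingale is constant.\<close>

definition mart :: "nat \<Rightarrow> 'd config \<Rightarrow> real" where
  "mart n \<sigma> = (if n = 0 then expectation g else (\<integral>\<tau>. g \<tau> \<partial>\<kappa> (site_at n) \<sigma>))"

text \<open>This will be the dominating function \<open>U\<close> of the martingale step that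
  reveals the \<open>n\<close>-th site.\<close>

definition incr_bound :: "nat \<Rightarrow> 'd config \<Rightarrow> real" where
  "incr_bound n \<sigma> = (\<Sum>y\<in>L. coupling_matrix Q \<sigma> (site_at n) y * variation g y)"

lemma \<Gamma>_site_at: "1 \<le> n \<Longrightarrow> \<Gamma> (site_at n) = n"
  unfolding site_at_def by (rule f_inv_into_f) (use enumeration in \<open>auto simp: bij_betw_def\<close>)

lemma inj_\<Gamma>: "inj \<Gamma>"
  using enumeration by (simp add: bij_betw_def)

lemma site_at_sites_upto: "1 \<le> n \<Longrightarrow> coord_algebra (sites_upto \<Gamma> (site_at n)) = filt n"
  by (simp add: filt_def sites_upto_def \<Gamma>_site_at)

lemma space_P: "space P = UNIV"
  using sets_eq_imp_space_eq[OF sets_P] by simp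

lemma subalgebra_filt: "subalgebra P (filt n)"
  using subalgebra_config_coord[of "{y. \<Gamma> y \<le> n}"] sets_P
  by (simp add: subalgebra_def filt_def space_P)

lemma subalgebra_filt_Suc: "subalgebra (filt (Suc n)) (filt n)"
  unfolding filt_def by (rule subalgebra_coord_mono) auto

sublocale F: finite_measure_subalgebra P "filt n" for n
  by unfold_locales (rule subalgebra_filt)

lemma measurable_filtD: "f \<in> borel_measurable (filt n) \<Longrightarrow> f \<in> borel_measurable P"
  by (rule measurable_from_subalg[OF subalgebra_filt])

lemma g_measurable_coord: "g \<in> borel_measurable (coord_algebra L)"
  using finite_L g_dep by (rule borel_measurable_coord_algebra)

lemma g_diff_le: "\<bar>g \<eta> - g \<zeta>\<bar> \<le> (\<Sum>y\<in>L. of_bool (\<eta> y \<noteq> \<zeta> y) * variation g y)"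
  using finite_L g_dep by (rule local_diff_le)

lemma variation_g_off: "y \<notin> L \<Longrightarrow> variation g y = 0"
  using g_dep by (rule variation_eq_0_off)

lemma finite_range_g: "finite (range g)"
  using finite_L g_dep by (rule finite_range_local)

lemma g_measurable_config: "g \<in> borel_measurable config_algebra"
  using measurable_from_subalg[OF subalgebra_config_coord g_measurable_coord] .

lemma g_measurable [measurable]: "g \<in> borel_measurable P"
  using g_measurable_config by (simp add: measurable_cong_sets[OF sets_P refl])

lemma level_set: "{\<tau>. g \<tau> = v} \<in> sets config_algebra"
  using measurable_sets[OF g_measurable_config, of "{v}"] by (simp add: vimage_def)

definition "g_bound = Max ((\<lambda>r. \<bar>r\<bar>) ` range g)"

lemma g_bound: "\<bar>g \<sigma>\<bar> \<le> g_bound"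
  unfolding g_bound_def using finite_range_g by (intro Max_ge) auto

lemma integrable_g: "integrable P g"
  using g_bound by (intro integrable_bounded) auto

lemma prob_kernel: "prob_space (\<kappa> x \<sigma>)" and sets_kernel: "sets (\<kappa> x \<sigma>) = sets config_algebra"
proof -
  have "\<kappa> x \<sigma> \<in> space (prob_algebra config_algebra)"
    using version[of x] by (auto simp: conditional_version_def dest!: measurable_space)
  then show "prob_space (\<kappa> x \<sigma>)" "sets (\<kappa> x \<sigma>) = sets config_algebra"
    by (auto simp: space_prob_algebra)
qed

lemma kernel_integral: "(\<integral>\<tau>. g \<tau> \<partial>\<kappa> x \<sigma>) = (\<Sum>v\<in>range g. v * measure (\<kappa> x \<sigma>) {\<tau>. g \<tau> = v})"
  by (rule integral_finite_range) (auto simp: prob_kernel finite_range_g sets_kernel level_set)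

lemma mart_measurable_filt: "mart n \<in> borel_measurable (filt n)"
proof (cases "n = 0")
  case False
  have "\<kappa> (site_at n) \<in> filt n \<rightarrow>\<^sub>M prob_algebra config_algebra"
    using version[of "site_at n"] False by (simp add: conditional_version_def site_at_sites_upto)
  then have [measurable]: "\<kappa> (site_at n) \<in> filt n \<rightarrow>\<^sub>M subprob_algebra config_algebra"
    by (rule measurable_prob_algebraD)
  note level_set [measurable]
  show ?thesis
    using False unfolding mart_def[abs_def] kernel_integral by simp
qed (simp add: mart_def[abs_def])

lemma mart_measurable [measurable]: "mart n \<in> borel_measurable P"
  using mart_measurable_filt by (rule measurable_filtD)

lemma abs_integral_g_le:
  assumes "prob_space \<mu>" "sets \<mu> = sets config_algebra"
  shows "\<bar>\<integral>\<tau>. g \<tau> \<partial>\<mu>\<bar> \<le> g_bound"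
proof -
  interpret \<mu>: prob_space \<mu> by fact
  have g: "g \<in> borel_measurable \<mu>"
    using g_measurable_config by (simp add: measurable_cong_sets[OF assms(2) refl])
  have "\<bar>\<integral>\<tau>. g \<tau> \<partial>\<mu>\<bar> \<le> (\<integral>\<tau>. \<bar>g \<tau>\<bar> \<partial>\<mu>)"
    by (rule integral_abs_bound)
  also have "\<dots> \<le> g_bound"
    using g g_bound by (intro \<mu>.integral_le_const \<mu>.integrable_bounded[where B = g_bound]) auto
  finally show ?thesis .
qed

lemma mart_bound: "\<bar>mart n \<sigma>\<bar> \<le> g_bound"
  using abs_integral_g_le[OF prob_kernel sets_kernel] abs_integral_g_le[OF prob_space_axioms sets_P]
  by (simp add: mart_def)

lemma integrable_mart: "integrable P (mart n)"
  using mart_bound by (intro integrable_bounded) auto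

text \<open>The kernel gives a version of the conditional expectation that is defined at every
  configuration and can be evaluated after changing a spin. The identity is known event by event,
  each with its own null set; as \<open>g\<close> has finite range, finitely many null sets
  suffice.\<close>

lemma mart_eq_cond_exp: "AE \<sigma> in P. real_cond_exp P (filt n) g \<sigma> = mart n \<sigma>"
proof (cases "n = 0")
  case True
  show ?thesis
  proof (rule F.real_cond_exp_charact)
    fix A assume "A \<in> sets (filt n)"
    \<comment> \<open>The enumeration starts at 1, so no site is revealed at time 0.\<close>
    moreover have "{y. \<Gamma> y \<le> n} = {}"
      using enumeration True by (auto simp: bij_betw_def)
    ultimately have "A = {} \<or> A = UNIV"
      unfolding filt_def by (simp only: sets_coord_algebra_empty) simp
    then show "set_lebesgue_integral P A g = set_lebesgue_integral P A (mart n)"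
      using True by (auto simp: mart_def[abs_def] set_lebesgue_integral_def prob_space)
  qed (auto simp: integrable_g integrable_mart mart_measurable_filt)
next
  case False
  have lev [measurable]: "{\<tau>. g \<tau> = v} \<in> sets P" for v
    using level_set by (simp add: sets_P)
  have int: "integrable P (\<lambda>\<tau>. v * indicator {\<tau>. g \<tau> = v} \<tau>)" for v :: real
    using lev by (simp add: emeasure_eq_measure)
  have "AE \<sigma> in P. real_cond_exp P (filt n) (\<lambda>\<tau>. \<Sum>v\<in>range g. v * indicator {\<tau>. g \<tau> = v} \<tau>) \<sigma>
      = (\<Sum>v\<in>range g. real_cond_exp P (filt n) (\<lambda>\<tau>. v * indicator {\<tau>. g \<tau> = v} \<tau>) \<sigma>)"
    by (rule F.real_cond_exp_sum) (rule int)
  moreover have "AE \<sigma> in P. \<forall>v\<in>range g. real_cond_exp P (filt n) (\<lambda>\<tau>. v * indicator {\<tau>. g \<tau> = v} \<tau>) \<sigma>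
      = v * real_cond_exp P (filt n) (indicator {\<tau>. g \<tau> = v}) \<sigma>"
    using finite_range_g lev
    by (intro AE_finite_allI F.real_cond_exp_cmult) (auto simp: emeasure_eq_measure)
  moreover have "AE \<sigma> in P. \<forall>v\<in>range g. measure (\<kappa> (site_at n) \<sigma>) {\<tau>. g \<tau> = v}
      = real_cond_exp P (filt n) (indicator {\<tau>. g \<tau> = v}) \<sigma>"
    using version[of "site_at n"] False finite_range_g level_set
    by (intro AE_finite_allI) (auto simp: conditional_version_def site_at_sites_upto)
  ultimately show ?thesis
  proof eventually_elim
    case (elim \<sigma>)
    have "real_cond_exp P (filt n) g \<sigma>
        = real_cond_exp P (filt n) (\<lambda>\<tau>. \<Sum>v\<in>range g. v * indicator {\<tau>. g \<tau> = v} \<tau>) \<sigma>"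
      by (subst finite_range_expand[OF finite_range_g]) simp
    also note elim(1)
    also have "(\<Sum>v\<in>range g. real_cond_exp P (filt n) (\<lambda>\<tau>. v * indicator {\<tau>. g \<tau> = v} \<tau>) \<sigma>)
        = (\<Sum>v\<in>range g. v * measure (\<kappa> (site_at n) \<sigma>) {\<tau>. g \<tau> = v})"
      by (rule sum.cong) (use elim(2,3) in auto)
    finally show ?case
      using False by (simp add: mart_def kernel_integral)
  qed
qed

text \<open>Once all of \<open>L\<close> is revealed, \<open>g\<close> is measurable for the past
  and equals its own conditional expectation almost everywhere.\<close>

lemma mart_final:
  assumes "\<And>y. y \<in> L \<Longrightarrow> \<Gamma> y \<le> N"
  shows "AE \<sigma> in P. mart N \<sigma> = g \<sigma>"
proof -
  have "L \<subseteq> {y. \<Gamma> y \<le> N}" using assms by auto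
  then have "g \<in> borel_measurable (filt N)"
    unfolding filt_def
    by (intro measurable_from_subalg[OF subalgebra_coord_mono g_measurable_coord])
  then have "AE \<sigma> in P. real_cond_exp P (filt N) g \<sigma> = g \<sigma>"
    using integrable_g by (intro F.real_cond_exp_F_meas)
  with mart_eq_cond_exp[of N] show ?thesis
    by eventually_elim simp
qed

text \<open>The right-hand side does not mention \<open>n\<close>: applied at two successive times
  to the same \<open>f\<close>, this makes \<open>f\<close> orthogonal to the increment.\<close>

lemma integral_filt_mult_mart:
  assumes f: "f \<in> borel_measurable (filt n)" and bnd: "\<And>\<sigma>. \<bar>f \<sigma>\<bar> \<le> B"
  shows "(\<integral>\<sigma>. f \<sigma> * mart n \<sigma> \<partial>P) = (\<integral>\<sigma>. f \<sigma> * g \<sigma> \<partial>P)"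
proof -
  note [measurable] = measurable_filtD[OF f]
  have "integrable P (\<lambda>\<sigma>. f \<sigma> * g \<sigma>)"
    by (rule integrable_bounded[where B = "B * g_bound"])
      (auto simp: abs_mult intro!: mult_mono bnd g_bound order_trans[OF abs_ge_zero bnd])
  then have "(\<integral>\<sigma>. f \<sigma> * g \<sigma> \<partial>P) = (\<integral>\<sigma>. f \<sigma> * real_cond_exp P (filt n) g \<sigma> \<partial>P)"
    using f by (intro F.real_cond_exp_intg(2)[symmetric]) auto
  also have "\<dots> = (\<integral>\<sigma>. f \<sigma> * mart n \<sigma> \<partial>P)"
  proof (rule integral_cong_AE)
    show "AE \<sigma> in P. f \<sigma> * real_cond_exp P (filt n) g \<sigma> = f \<sigma> * mart n \<sigma>"
      using mart_eq_cond_exp[of n] by eventually_elim simp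
  qed auto
  finally show ?thesis ..
qed

lemma coupling_matrix_bounds: "0 \<le> coupling_matrix Q \<sigma> x y" "coupling_matrix Q \<sigma> x y \<le> 1"
proof -
  have "prob_space (Q x \<sigma>)"
    using couplings[of x \<sigma>] by (simp add: coupling_def)
  then show "0 \<le> coupling_matrix Q \<sigma> x y" "coupling_matrix Q \<sigma> x y \<le> 1"
    by (auto simp: coupling_matrix_def prob_space.prob_le_1)
qed

section \<open>Control of the increments through the coupling\<close>

text \<open>Both integrals become expectations under the one coupling \<open>Q x \<sigma>\<close>.
  The site-by-site bound then holds pointwise, and the expected indicator of disagreement at
  \<open>y\<close> is the entry of the coupling matrix.\<close>

lemma kernel_diff_le:
  "\<bar>(\<integral>\<tau>. g \<tau> \<partial>\<kappa> x (\<sigma>(x := True))) - (\<integral>\<tau>. g \<tau> \<partial>\<kappa> x (\<sigma>(x := False)))\<bar>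
    \<le> (\<Sum>y\<in>L. coupling_matrix Q \<sigma> x y * variation g y)"
proof -
  let ?Q = "Q x \<sigma>"
  have Q: "prob_space ?Q" "sets ?Q = sets (config_algebra \<Otimes>\<^sub>M config_algebra)"
    and d1: "distr ?Q config_algebra fst = \<kappa> x (\<sigma>(x := True))"
    and d2: "distr ?Q config_algebra snd = \<kappa> x (\<sigma>(x := False))"
    using couplings[of x \<sigma>] by (auto simp: coupling_def)
  interpret Q: prob_space ?Q by fact
  have m: "fst \<in> ?Q \<rightarrow>\<^sub>M config_algebra" "snd \<in> ?Q \<rightarrow>\<^sub>M config_algebra"
    by (simp_all add: measurable_cong_sets[OF Q(2) refl])
  have [measurable]: "(\<lambda>z. g (fst z)) \<in> borel_measurable ?Q" "(\<lambda>z. g (snd z)) \<in> borel_measurable ?Q"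
    using m g_measurable_config by (auto intro: measurable_compose)
  have int: "integrable ?Q (\<lambda>z. g (fst z))" "integrable ?Q (\<lambda>z. g (snd z))"
    using g_bound by (auto intro!: Q.integrable_bounded)
  have comp: "(\<lambda>z. fst z y) \<in> ?Q \<rightarrow>\<^sub>M count_space UNIV" "(\<lambda>z. snd z y) \<in> ?Q \<rightarrow>\<^sub>M count_space UNIV" for y
    using m measurable_config_component[of y] by (auto intro: measurable_compose)
  have "{z \<in> space ?Q. fst z y \<noteq> snd z y} \<in> sets ?Q" for y
    using comp[of y] by measurable
  moreover have spQ: "space ?Q = UNIV"
    using sets_eq_imp_space_eq[OF Q(2)] by (simp add: space_pair_measure)
  ultimately have S: "{z. fst z y \<noteq> snd z y} \<in> sets ?Q" for y
    by simp
  have intS: "integrable ?Q (\<lambda>z. indicator {z. fst z y \<noteq> snd z y} z * variation g y)" for y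
    using S[of y] by (simp add: Q.emeasure_eq_measure)
  have "(\<integral>\<tau>. g \<tau> \<partial>\<kappa> x (\<sigma>(x := True))) - (\<integral>\<tau>. g \<tau> \<partial>\<kappa> x (\<sigma>(x := False)))
      = (\<integral>z. g (fst z) - g (snd z) \<partial>?Q)"
    unfolding d1[symmetric] d2[symmetric] using int m g_measurable_config
    by (simp add: integral_distr)
  also have "\<bar>\<dots>\<bar> \<le> (\<integral>z. \<bar>g (fst z) - g (snd z)\<bar> \<partial>?Q)"
    by (rule integral_abs_bound)
  also have "\<dots> \<le> (\<integral>z. (\<Sum>y\<in>L. indicator {z. fst z y \<noteq> snd z y} z * variation g y) \<partial>?Q)"
  proof (rule integral_mono)
    show "integrable ?Q (\<lambda>z. \<bar>g (fst z) - g (snd z)\<bar>)"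
      using int by auto
    show "integrable ?Q (\<lambda>z. \<Sum>y\<in>L. indicator {z. fst z y \<noteq> snd z y} z * variation g y)"
      using intS by auto
    fix z
    show "\<bar>g (fst z) - g (snd z)\<bar> \<le> (\<Sum>y\<in>L. indicator {z. fst z y \<noteq> snd z y} z * variation g y)"
      using g_diff_le[of "fst z" "snd z"]
      by (simp add: indicator_def of_bool_def)
  qed
  also have "\<dots> = (\<Sum>y\<in>L. measure ?Q {z. fst z y \<noteq> snd z y} * variation g y)"
    using intS S by (simp add: spQ Q.emeasure_eq_measure)
  also have "\<dots> = (\<Sum>y\<in>L. coupling_matrix Q \<sigma> x y * variation g y)"
    by (simp add: coupling_matrix_def case_prod_unfold)
  finally show ?thesis .
qed

text \<open>Given the past, \<open>mart (Suc n)\<close> takes one of the two values \<open>a\<close> and \<open>b\<close>, according to the spin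
  at the new site; both are known from the past, so the conditional mean \<open>mart n\<close> lies between them.\<close>

lemma mart_increment_le:
  "AE \<sigma> in P. \<bar>mart (Suc n) \<sigma> - mart n \<sigma>\<bar> \<le> incr_bound (Suc n) \<sigma>"
proof -
  define x where "x = site_at (Suc n)"
  define a b where "a \<sigma> = mart (Suc n) (\<sigma>(x := True))" and "b \<sigma> = mart (Suc n) (\<sigma>(x := False))" for \<sigma>
  have \<Gamma>x: "\<Gamma> x = Suc n"
    by (simp add: x_def \<Gamma>_site_at)
  \<comment> \<open>Overwriting the spin at \<open>x\<close> removes the dependence on it, so what
    is known after \<open>Suc n\<close> sites becomes known after \<open>n\<close> sites.\<close>
  have upd: "(\<lambda>\<sigma>. \<sigma>(x := s)) \<in> filt n \<rightarrow>\<^sub>M filt (Suc n)" for s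
    unfolding filt_def
  proof (rule measurable_into_coord_algebra)
    fix y assume y: "y \<in> {y. \<Gamma> y \<le> Suc n}"
    show "(\<lambda>\<sigma>. (\<sigma>(x := s)) y) \<in> coord_algebra {y. \<Gamma> y \<le> n} \<rightarrow>\<^sub>M count_space UNIV"
    proof (cases "y = x")
      case False
      then have "\<Gamma> y \<noteq> \<Gamma> x"
        using inj_\<Gamma> by (auto dest: injD)
      with y \<Gamma>x have "y \<in> {y. \<Gamma> y \<le> n}" by auto
      with False show ?thesis
        by (simp add: measurable_coord_component)
    qed simp
  qed
  have ab [measurable]: "a \<in> borel_measurable (filt n)" "b \<in> borel_measurable (filt n)"
    unfolding a_def[abs_def] b_def[abs_def] using measurable_compose[OF upd mart_measurable_filt] by auto
  have ab_bound: "\<bar>a \<sigma>\<bar> \<le> g_bound" "\<bar>b \<sigma>\<bar> \<le> g_bound" for \<sigma>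
    by (simp_all add: a_def b_def mart_bound)
  have mm: "(\<lambda>\<sigma>. max (a \<sigma>) (b \<sigma>)) \<in> borel_measurable (filt n)"
      "(\<lambda>\<sigma>. min (a \<sigma>) (b \<sigma>)) \<in> borel_measurable (filt n)"
    by measurable
  have mi: "integrable P (\<lambda>\<sigma>. max (a \<sigma>) (b \<sigma>))" "integrable P (\<lambda>\<sigma>. min (a \<sigma>) (b \<sigma>))"
    using mm[THEN measurable_filtD] ab_bound
    by (auto intro!: integrable_bounded[where B = g_bound] simp: max_def min_def)
  have between: "mart (Suc n) \<sigma> = a \<sigma> \<or> mart (Suc n) \<sigma> = b \<sigma>" for \<sigma>
    using fun_upd_triv[of \<sigma> x] unfolding a_def b_def by (cases "\<sigma> x") (metis, metis)
  \<comment> \<open>Conditioning preserves the bounds by the maximum and minimum of \<open>a\<close>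
    and \<open>b\<close>, and leaves these two unchanged because they are known from the
    past.\<close>
  have "AE \<sigma> in P. real_cond_exp P (filt n) (mart (Suc n)) \<sigma> \<le> real_cond_exp P (filt n) (\<lambda>\<sigma>. max (a \<sigma>) (b \<sigma>)) \<sigma>"
    using between mi integrable_mart by (intro F.real_cond_exp_mono AE_I2) (auto simp: max_def, metis linear, metis linear)
  moreover have "AE \<sigma> in P. real_cond_exp P (filt n) (\<lambda>\<sigma>. min (a \<sigma>) (b \<sigma>)) \<sigma> \<le> real_cond_exp P (filt n) (mart (Suc n)) \<sigma>"
    using between mi integrable_mart by (intro F.real_cond_exp_mono AE_I2) (auto simp: min_def, metis linear, metis linear)
  moreover have "AE \<sigma> in P. real_cond_exp P (filt n) (\<lambda>\<sigma>. max (a \<sigma>) (b \<sigma>)) \<sigma> = max (a \<sigma>) (b \<sigma>)"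
    using mi mm by (intro F.real_cond_exp_F_meas) auto
  moreover have "AE \<sigma> in P. real_cond_exp P (filt n) (\<lambda>\<sigma>. min (a \<sigma>) (b \<sigma>)) \<sigma> = min (a \<sigma>) (b \<sigma>)"
    using mi mm by (intro F.real_cond_exp_F_meas) auto
  \<comment> \<open>The tower property identifies the conditional mean of
    \<open>mart (Suc n)\<close> with \<open>mart n\<close>.\<close>
  moreover have "AE \<sigma> in P. real_cond_exp P (filt n) (real_cond_exp P (filt (Suc n)) g) \<sigma>
      = real_cond_exp P (filt n) (mart (Suc n)) \<sigma>"
    by (intro F.real_cond_exp_cong mart_eq_cond_exp) auto
  moreover have "AE \<sigma> in P. real_cond_exp P (filt n) (real_cond_exp P (filt (Suc n)) g) \<sigma>
      = real_cond_exp P (filt n) g \<sigma>"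
    by (intro F.real_cond_exp_nested_subalg subalgebra_filt subalgebra_filt_Suc integrable_g)
  moreover note mart_eq_cond_exp[of n]
  ultimately show ?thesis
  proof eventually_elim
    case (elim \<sigma>)
    have "\<bar>a \<sigma> - b \<sigma>\<bar> \<le> incr_bound (Suc n) \<sigma>"
      using kernel_diff_le[of x \<sigma>] by (simp add: a_def b_def mart_def incr_bound_def x_def)
    \<comment> \<open>Both martingale values lie between \<open>a \<sigma>\<close> and
      \<open>b \<sigma>\<close>, an interval of length
      \<open>\<bar>a \<sigma> - b \<sigma>\<bar>\<close>.\<close>
    with elim between[of \<sigma>] show ?case by linarith
  qed
qed

lemma variation_g_nonneg: "0 \<le> variation g y"
  using finite_range_g by (rule variation_nonneg)

lemma incr_bound_measurable [measurable]: "incr_bound n \<in> borel_measurable P"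
  unfolding incr_bound_def[abs_def] by measurable

lemma incr_bound_bounds: "\<bar>incr_bound n \<sigma>\<bar> \<le> (\<Sum>y\<in>L. variation g y)"
  unfolding incr_bound_def
  by (subst abs_of_nonneg)
    (auto intro!: sum_nonneg sum_mono mult_nonneg_nonneg mult_left_le_one_le
      simp: coupling_matrix_bounds variation_g_nonneg)

text \<open>A bound for the \<open>2p\<close>-norm of \<open>incr_bound n\<close>, with each random
  matrix entry replaced by its own \<open>2p\<close>-norm.\<close>

definition "moment_bound p n = (\<Sum>y\<in>L. moment_matrix P (coupling_matrix Q) (2 * p) (site_at n) y * variation g y)"

lemma moment_matrix_nonneg: "0 \<le> moment_matrix P (coupling_matrix Q) q x y"
  by (cases "q = 0") (auto simp: moment_matrix_def coupling_matrix_bounds)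

lemma moment_bound_nonneg: "0 \<le> moment_bound p n"
  unfolding moment_bound_def by (intro sum_nonneg mult_nonneg_nonneg moment_matrix_nonneg variation_g_nonneg)

text \<open>Minkowski over the sites of \<open>L\<close>; for a single site the power undoes the
  root in \<open>moment_matrix\<close>, so equality holds there.\<close>

lemma integral_incr_bound_le:
  assumes "1 \<le> p"
  shows "(\<integral>\<sigma>. incr_bound n \<sigma> ^ (2 * p) \<partial>P) \<le> moment_bound p n ^ (2 * p)"
  unfolding incr_bound_def moment_bound_def
proof (rule integral_power_sum_le[where B = "variation g"])
  fix y
  let ?D = "\<lambda>\<sigma>. coupling_matrix Q \<sigma> (site_at n) y"
  show "(\<integral>\<sigma>. (?D \<sigma> * variation g y) ^ (2 * p) \<partial>P)
      \<le> (moment_matrix P (coupling_matrix Q) (2 * p) (site_at n) y * variation g y) ^ (2 * p)"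
    using assms by (simp add: power_mult_distrib moment_matrix_def coupling_matrix_bounds)
qed (use assms in \<open>auto simp: finite_L coupling_matrix_bounds variation_g_nonneg moment_matrix_nonneg
    intro!: mult_left_le_one_le\<close>)

lemma mart_moment_le:
  assumes p: "1 \<le> p"
  shows "(\<integral>\<sigma>. (mart n \<sigma> - expectation g) ^ (2 * p) \<partial>P)
    \<le> (\<Sum>k=1..n. 8 * real p * (moment_bound p k)\<^sup>2) ^ p"
proof (induction n)
  case 0
  then show ?case using p by (simp add: mart_def power_0_left)
next
  case (Suc n)
  let ?W = "\<lambda>\<sigma>. mart n \<sigma> - expectation g" and ?V = "\<lambda>\<sigma>. mart (Suc n) \<sigma> - mart n \<sigma>"
  \<comment> \<open>A single bound that serves for \<open>?W\<close>, \<open>?V\<close> and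
    \<open>incr_bound\<close> at once.\<close>
  let ?B = "2 * g_bound + (\<Sum>y\<in>L. variation g y)"
  have c: "\<bar>expectation g\<bar> \<le> g_bound"
    by (rule abs_integral_g_le[OF prob_space_axioms sets_P])
  have v0: "0 \<le> (\<Sum>y\<in>L. variation g y)"
    by (intro sum_nonneg variation_g_nonneg)
  have W: "\<bar>?W \<sigma>\<bar> \<le> 2 * g_bound" "\<bar>?V \<sigma>\<bar> \<le> 2 * g_bound" for \<sigma>
    using mart_bound[of n \<sigma>] mart_bound[of "Suc n" \<sigma>] c by linarith+
  have f: "(\<lambda>\<sigma>. ?W \<sigma> ^ (2 * p - 1)) \<in> borel_measurable (filt n)"
    using mart_measurable_filt by measurable
  have fb: "\<bar>?W \<sigma> ^ (2 * p - 1)\<bar> \<le> (2 * g_bound) ^ (2 * p - 1)" for \<sigma>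
    unfolding power_abs by (intro power_mono W) simp
  have int: "integrable P (\<lambda>\<sigma>. ?W \<sigma> ^ (2 * p - 1) * mart m \<sigma>)" for m
  proof (rule integrable_bounded)
    show "\<bar>?W \<sigma> ^ (2 * p - 1) * mart m \<sigma>\<bar> \<le> (2 * g_bound) ^ (2 * p - 1) * g_bound" for \<sigma>
      unfolding abs_mult by (intro mult_mono fb mart_bound order_trans[OF abs_ge_zero fb]) simp
  qed measurable
  \<comment> \<open>The factor \<open>?W ^ (2 * p - 1)\<close> is known at time \<open>n\<close>,
    hence also at time \<open>Suc n\<close>, so against it both martingale values integrate like
    \<open>g\<close>.\<close>
  have "(\<integral>\<sigma>. ?W \<sigma> ^ (2 * p - 1) * ?V \<sigma> \<partial>P)
      = (\<integral>\<sigma>. ?W \<sigma> ^ (2 * p - 1) * mart (Suc n) \<sigma> \<partial>P) - (\<integral>\<sigma>. ?W \<sigma> ^ (2 * p - 1) * mart n \<sigma> \<partial>P)"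
    using int by (simp add: right_diff_distrib)
  also have "\<dots> = 0"
    using integral_filt_mult_mart[OF f fb]
      integral_filt_mult_mart[OF measurable_from_subalg[OF subalgebra_filt_Suc f] fb] by simp
  finally have orth: "(\<integral>\<sigma>. ?W \<sigma> ^ (2 * p - 1) * ?V \<sigma> \<partial>P) = 0" .
  have "(\<integral>\<sigma>. (?W \<sigma> + ?V \<sigma>) ^ (2 * p) \<partial>P)
      \<le> ((\<Sum>k=1..n. 8 * real p * (moment_bound p k)\<^sup>2) + 8 * real p * (moment_bound p (Suc n))\<^sup>2) ^ p"
  proof (rule martingale_step_moment_le[OF p _ _ _ _ _ _ orth mart_increment_le
        integral_incr_bound_le[OF p] moment_bound_nonneg Suc.IH])
    show "\<bar>?W \<sigma>\<bar> \<le> ?B" "\<bar>?V \<sigma>\<bar> \<le> ?B" "\<bar>incr_bound (Suc n) \<sigma>\<bar> \<le> ?B" for \<sigma>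
      using W[of \<sigma>] v0 incr_bound_bounds[of "Suc n" \<sigma>] by linarith+
  qed (auto intro!: sum_nonneg)
  then show ?case by simp
qed

end

section \<open>From the martingale to the operator norm\<close>

lemma (in coupled_field) moment_matrix_apply:
  "mat_apply (moment_matrix P (coupling_matrix Q) (2 * p)) (variation g) (site_at n) = moment_bound p n"
  unfolding mat_apply_def moment_bound_def
  by (subst infsum_cong_neutral[where T = L])
    (auto simp: variation_g_off finite_L)

lemma (in coupled_field) variation_ell2: "variation g \<in> ell2"
proof -
  have "(\<lambda>x. (variation g x)\<^sup>2) summable_on L"
    using finite_L by simp
  then show ?thesis
    unfolding ell2_def mem_Collect_eq
    by (rule summable_on_cong_neutral[THEN iffD1, rotated -1])
      (auto simp: variation_g_off)
qed

text \<open>The numbers \<open>moment_bound p k\<close> are the components of the image vector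
  \<open>w\<close> at distinct sites, so their squares sum to at most its squared norm, however many
  steps are needed to exhaust \<open>L\<close>.\<close>

lemma (in coupled_field) centered_moment_le:
  assumes p: "1 \<le> p"
    and C: "0 \<le> C" "mat_apply (moment_matrix P (coupling_matrix Q) (2 * p)) (variation g) \<in> ell2"
      "ell2_norm (mat_apply (moment_matrix P (coupling_matrix Q) (2 * p)) (variation g)) \<le> C * ell2_norm (variation g)"
  shows "(\<integral>\<sigma>. (g \<sigma> - expectation g) ^ (2 * p) \<partial>P)
    \<le> (20 * real p) ^ (2 * p) * C ^ (2 * p) * ell2_norm (variation g) ^ (2 * p)"
proof -
  define w where "w = mat_apply (moment_matrix P (coupling_matrix Q) (2 * p)) (variation g)"
  \<comment> \<open>Inserting 0 keeps the maximum meaningful when \<open>L\<close> is empty.\<close>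
  define N where "N = Max (insert 0 (\<Gamma> ` L))"
  have N: "\<Gamma> y \<le> N" if "y \<in> L" for y
    unfolding N_def using that finite_L by (intro Max_ge) auto
  have summ: "(\<lambda>x. (w x)\<^sup>2) summable_on UNIV"
    using C(2) by (simp add: ell2_def w_def)
  have inj: "inj_on site_at {1..N}"
    by (rule inj_on_inverseI[where g = \<Gamma>]) (simp add: \<Gamma>_site_at)
  have "(\<Sum>k=1..N. (moment_bound p k)\<^sup>2) = (\<Sum>x\<in>site_at ` {1..N}. (w x)\<^sup>2)"
    unfolding sum.reindex[OF inj] by (simp add: w_def moment_matrix_apply)
  also have "\<dots> = (\<Sum>\<^sub>\<infinity>x\<in>site_at ` {1..N}. (w x)\<^sup>2)"
    by simp
  also have "\<dots> \<le> (\<Sum>\<^sub>\<infinity>x. (w x)\<^sup>2)"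
    using summ by (intro infsum_mono2) auto
  also have "\<dots> = (ell2_norm w)\<^sup>2"
    by (simp add: ell2_norm_def infsum_nonneg)
  also have "\<dots> \<le> (C * ell2_norm (variation g))\<^sup>2"
    using C(3) unfolding w_def by (intro power_mono) (auto simp: ell2_norm_def infsum_nonneg)
  finally have sum_le: "(\<Sum>k=1..N. (moment_bound p k)\<^sup>2) \<le> (C * ell2_norm (variation g))\<^sup>2" .
  \<comment> \<open>As \<open>p \<ge> 1\<close>, the factor \<open>8 * p\<close> is at most
    \<open>400 * p^2\<close>.\<close>
  have "real p * 1 \<le> real p * real p"
    using p by (intro mult_left_mono) auto
  then have const: "8 * real p \<le> (20 * real p)\<^sup>2"
    by (simp add: power2_eq_square)
  have "(\<integral>\<sigma>. (g \<sigma> - expectation g) ^ (2 * p) \<partial>P) = (\<integral>\<sigma>. (mart N \<sigma> - expectation g) ^ (2 * p) \<partial>P)"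
    by (rule integral_cong_AE) (use mart_final[OF N] in auto)
  also have "\<dots> \<le> (8 * real p * (\<Sum>k=1..N. (moment_bound p k)\<^sup>2)) ^ p"
    using mart_moment_le[OF p, of N] by (simp add: sum_distrib_left)
  also have "\<dots> \<le> ((20 * real p)\<^sup>2 * (C * ell2_norm (variation g))\<^sup>2) ^ p"
    by (intro power_mono mult_mono const sum_le mult_nonneg_nonneg sum_nonneg) auto
  also have "\<dots> = (20 * real p) ^ (2 * p) * C ^ (2 * p) * ell2_norm (variation g) ^ (2 * p)"
    by (simp add: power_mult power_mult_distrib)
  finally show ?thesis .
qed

lemma (in coupled_field) constant_if_variation_0:
  assumes "ell2_norm (variation g) = 0"
  shows "g \<sigma> = g \<tau>"
proof -
  have "(\<Sum>\<^sub>\<infinity>x. (variation g x)\<^sup>2) = 0"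
    using assms by (simp add: ell2_norm_def)
  then have "variation g y = 0" for y
    using nonneg_infsum_le_0D[of "\<lambda>x. (variation g x)\<^sup>2" UNIV y] variation_ell2
    by (simp add: ell2_def)
  then show ?thesis
    using g_diff_le[of \<sigma> \<tau>] by simp
qed

theorem theorem6:
  fixes \<Gamma> :: "('d::finite) site \<Rightarrow> nat"
    and P :: "'d config measure"
    and \<kappa> :: "'d site \<Rightarrow> 'd config \<Rightarrow> 'd config measure"
    and Q :: "'d site \<Rightarrow> 'd config \<Rightarrow> ('d config \<times> 'd config) measure"
    and g :: "'d config \<Rightarrow> real"
    and p :: nat
  assumes "spiraling_enumeration \<Gamma>"
    and "prob_space P" and "sets P = sets config_algebra"
    and "\<And>x. conditional_version \<Gamma> P x (\<kappa> x)"
    and "\<And>x \<sigma>. maximal_coupling (sites_upto \<Gamma> x)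
           (\<kappa> x (\<sigma>(x := True))) (\<kappa> x (\<sigma>(x := False))) (Q x \<sigma>)"
    and "\<And>x y. (\<lambda>\<sigma>. coupling_matrix Q \<sigma> x y) \<in> borel_measurable P"
    and "local_function g"
    and "p \<ge> 1"
  shows "ennreal (\<integral>\<sigma>. (g \<sigma> - (\<integral>\<tau>. g \<tau> \<partial>P)) ^ (2 * p) \<partial>P)
     \<le> ennreal ((20 * real p) ^ (2 * p))
        * ell2_opnorm (moment_matrix P (coupling_matrix Q) (2 * p)) ^ (2 * p)
        * ennreal (ell2_norm (variation g)) ^ (2 * p)"
proof -
  obtain L where "finite L" and "\<forall>\<sigma> \<tau>. (\<forall>x\<in>L. \<sigma> x = \<tau> x) \<longrightarrow> g \<sigma> = g \<tau>"
    using assms(7) unfolding local_function_def by (elim exE conjE)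
  then have L: "finite L" "\<And>\<sigma> \<tau>. (\<And>x. x \<in> L \<Longrightarrow> \<sigma> x = \<tau> x) \<Longrightarrow> g \<sigma> = g \<tau>"
    by simp_all
  interpret prob_space P by fact
  interpret coupled_field P \<Gamma> \<kappa> Q g L
  proof
    show "bij_betw \<Gamma> UNIV {1..}"
      using assms(1) by (simp add: spiraling_enumeration_def)
    show "coupling (\<kappa> x (\<sigma>(x := True))) (\<kappa> x (\<sigma>(x := False))) (Q x \<sigma>)" for x \<sigma>
      using assms(5) by (simp add: maximal_coupling_def)
  qed (fact assms(3,4,6) L)+
  define I where "I = (\<integral>\<sigma>. (g \<sigma> - expectation g) ^ (2 * p) \<partial>P)"
  define n where "n = ell2_norm (variation g)"
  define K where "K = 20 * real p"
  define M where "M = moment_matrix P (coupling_matrix Q) (2 * p)"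
  have I0: "0 \<le> I"
    unfolding I_def by (intro integral_nonneg_AE) (simp add: zero_le_even_power)
  have n0: "0 \<le> n"
    by (simp add: n_def ell2_norm_def infsum_nonneg)
  have K: "0 < K"
    using assms(8) by (simp add: K_def)
  have "ennreal I \<le> ennreal (K ^ (2 * p)) * ell2_opnorm M ^ (2 * p) * ennreal n ^ (2 * p)"
  \<comment> \<open>When \<open>n = 0\<close> the right-hand side is 0 even for an infinite operator
    norm, because infinity times 0 is 0 in \<open>ennreal\<close>. Then \<open>g\<close> is constant
    and the moment vanishes too.\<close>
  proof (cases "n = 0")
    case True
    then obtain c where "g = (\<lambda>_. c)"
      using constant_if_variation_0 unfolding n_def by (metis ext)
    then show ?thesis
      using assms(8) by (simp add: I_def prob_space power_0_left)
  next
    case False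
    \<comment> \<open>\<open>r\<close> is the operator norm for which the claim would be an
      equality. It lies below every admissible \<open>C\<close>, hence below their infimum, which
      also covers the case that no \<open>C\<close> is admissible.\<close>
    define r where "r = root (2 * p) I / (K * n)"
    have n: "0 < n" using False n0 by simp
    have Kn: "0 < K * n" using K n by simp
    have r0: "0 \<le> r"
      unfolding r_def using I0 Kn by (intro divide_nonneg_pos real_root_ge_zero)
    have "ennreal r \<le> ell2_opnorm M"
      unfolding ell2_opnorm_def
    proof (rule INF_greatest, unfold mem_Collect_eq, elim conjE)
      fix C :: real
      assume "0 \<le> C" and C: "\<forall>v\<in>ell2. (\<forall>x. (\<lambda>y. M x y * v y) summable_on UNIV) \<and>
        mat_apply M v \<in> ell2 \<and> ell2_norm (mat_apply M v) \<le> C * ell2_norm v"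
      have "I \<le> K ^ (2 * p) * C ^ (2 * p) * n ^ (2 * p)"
        unfolding I_def K_def n_def using C variation_ell2 \<open>0 \<le> C\<close>
        by (intro centered_moment_le[OF assms(8)]) (auto simp: M_def)
      also have "\<dots> = (C * (K * n)) ^ (2 * p)"
        by (simp add: power_mult_distrib)
      finally have "root (2 * p) I \<le> root (2 * p) ((C * (K * n)) ^ (2 * p))"
        using assms(8) by simp
      also have "\<dots> = C * (K * n)"
        using assms(8) \<open>0 \<le> C\<close> Kn by (intro real_root_power_cancel) auto
      finally show "ennreal r \<le> ennreal C"
        using Kn by (intro ennreal_leI) (simp add: r_def divide_le_eq)
    qed
    then have "ennreal (K ^ (2 * p)) * ennreal r ^ (2 * p) * ennreal n ^ (2 * p)
        \<le> ennreal (K ^ (2 * p)) * ell2_opnorm M ^ (2 * p) * ennreal n ^ (2 * p)"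
      by (intro mult_mono power_mono) auto
    also have "ennreal (K ^ (2 * p)) * ennreal r ^ (2 * p) * ennreal n ^ (2 * p)
        = ennreal ((r * (K * n)) ^ (2 * p))"
      using K n r0 by (simp add: ennreal_power power_mult_distrib mult_ac flip: ennreal_mult)
    also have "(r * (K * n)) ^ (2 * p) = I"
      using Kn K n I0 assms(8) by (simp add: r_def real_root_pow_pos2)
    finally show ?thesis .
  qed
  then show ?thesis
    by (simp only: I_def n_def K_def M_def)
qed

end
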